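(* As formal power series in $q$, \begin{align*}\Psi(-q^2,q) &= (q;q)_\infty \left(1 - 2\left(\mathcal{M}_2 - \mathcal{M}_4 + \mathcal{M}_6 - \mathcal{M}_8 + \cdots\right) \right) \\ &= (q;q)_\infty \left(1 - 2 \sum_{j=1}^\infty (-1)^{j+1} \sum_{n=2j}^\infty \frac{q^{\binom{2j}{2}+(2j+1)n}}{(q;q)_n} \begin{bmatrix} n-1 \\ 2j-1 \end{bmatrix}_q \right). \end{align*}
   Context: The false theta function is the formal power series in $q$ (for $a,b$ equal to signed powers of $q$) given by $$\Psi(a,b) := \sum_{n=0}^\infty a^{\binom{n+1}{2}} b^{\binom{n}{2}} - \sum_{n=-\infty}^{-1} a^{\binom{n+1}{2}} b^{\binom{n}{2}},$$ where for every integer $n$, $\binom{n+1}{2} = n(n+1)/2$ and $\binom{n}{2} = n(n-1)/2$. Notation: $(q;q)_n = \prod_{k=1}^{n}(1-q^k)$, $(q;q)_\infty = \prod_{k\ge 1}(1-q^k)$, and $\begin{bmatrix} m \\ r \end{bmatrix}_q = \frac{(q;q)_m}{(q;q)_r (q;q)_{m-r}}$ for $0\le r\le m$ is the $q$-binomial coefficient. For $k \ge 1$, $M_k(n)$ is the number of partitions of $n$ in which $k$ is the least positive integer not appearing as a part and there are more parts larger than $k$ than parts smaller than $k$ (parts counted with multiplicity), and $\mathcal{M}_k := \sum_{n=0}^\infty M_k(n) q^n$. It is a known result of Andrews and Merca that $$\mathcal{M}_k = \sum_{n=k}^\infty \frac{q^{\binom{k}{2}+(k+1)n}}{(q;q)_n}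 \begin{bmatrix} n-1 \\ k-1 \end{bmatrix}_q.$$ The infinite sum $\mathcal{M}_2 - \mathcal{M}_4 + \mathcal{M}_6 - \cdots = \sum_{j\ge1}(-1)^{j+1}\mathcal{M}_{2j}$ converges as a formal power series. *)

theory Defs
  imports
    "HOL-Analysis.Analysis"
    "HOL-Computational_Algebra.Formal_Power_Series"
    "HOL-Library.Multiset"
begin

text \<open>
  All identities live in the ring \<^typ>\<open>rat fps\<close>, with \<open>q\<close> rendered as \<^term>\<open>fps_X\<close>.
  Infinite sums and products are taken in the topology that the library puts on formal power
  series, in which convergence means that every coefficient is eventually constant.
\<close>

definition false_theta :: "rat fps \<Rightarrow> rat fps \<Rightarrow> rat fps" where
  "false_theta a b =
     (\<Sum>\<^sub>\<infinity>n\<in>{0::int..}. a ^ nat (n * (n + 1) div 2) * b ^ nat (n * (n - 1) div 2)) -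
     (\<Sum>\<^sub>\<infinity>n\<in>{..-1::int}. a ^ nat (n * (n + 1) div 2) * b ^ nat (n * (n - 1) div 2))"

definition qq :: "nat \<Rightarrow> rat fps" where
  "qq n = (\<Prod>k=1..n. 1 - fps_X ^ k)"

definition qq_inf :: "rat fps" where
  "qq_inf = (\<Prod>k. 1 - fps_X ^ Suc k)"

text \<open>Meant for \<open>r \<le> m\<close>; the denominator has constant coefficient 1, so it is a unit.\<close>

definition qbinom :: "nat \<Rightarrow> nat \<Rightarrow> rat fps" where
  "qbinom m r = qq m / (qq r * qq (m - r))"

definition partitions :: "nat \<Rightarrow> nat multiset set" where
  "partitions n = {p. 0 \<notin># p \<and> \<Sum>\<^sub># p = n}"

definition min_missing :: "nat multiset \<Rightarrow> nat" where
  "min_missing p = (LEAST i. 0 < i \<and> i \<notin># p)"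

definition M_count :: "nat \<Rightarrow> nat \<Rightarrow> nat" where
  "M_count k n =
     card {p \<in> partitions n. min_missing p = k \<and>
             size {#i \<in># p. i > k#} > size {#i \<in># p. i < k#}}"

definition M_gf :: "nat \<Rightarrow> rat fps" where
  "M_gf k = Abs_fps (\<lambda>n. of_nat (M_count k n))"


text \<open>
  The operators for infinite sums, infinite products and cardinalities return default values
  where they are not meaningful. The following facts show that this never happens in the
  objects above.
\<close>

lemma finite_partitions: "finite (partitions n)"
proof (rule finite_subset)
  show "partitions n \<subseteq> (\<Union>k\<le>n. multisets_of_size {..n} k)"
  proof
    fix p assume p: "p \<in> partitions n"
    have "set_mset p \<subseteq> {..n}"
      using p by (auto simp: partitions_def sum_mset.remove)
    moreover have "size p \<le> \<Sum>\<^sub># p" if "0 \<notin># p"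
      using that by (induction p) (auto simp: Suc_le_eq)
    ultimately show "p \<in> (\<Union>k\<le>n. multisets_of_size {..n} k)"
      using p by (auto simp: partitions_def multisets_of_size_def)
  qed
qed auto

lemma summable_on_fpsI:
  fixes F :: "'b \<Rightarrow> rat fps"
  assumes "\<And>n. finite {x\<in>A. fps_nth (F x) n \<noteq> 0}"
  shows "F summable_on A"
proof -
  have "(F has_sum Abs_fps (\<lambda>n. \<Sum>x | x \<in> A \<and> fps_nth (F x) n \<noteq> 0. fps_nth (F x) n)) A"
    by (rule has_sum_fpsI) (use assms in auto)
  thus ?thesis by (auto simp: summable_on_def)
qed

lemma fps_X_power_dvd_nth_0:
  fixes f :: "rat fps"
  assumes "fps_X ^ m dvd f" "n < m"
  shows "fps_nth f n = 0"
  using assms by (auto elim!: dvdE simp: fps_X_power_mult_nth)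

lemma M_count_eq_0:
  assumes "n + 1 < k"
  shows "M_count k n = 0"
proof -
  have False if p: "p \<in> partitions n" "min_missing p = k" for p
  proof -
    have "k - 1 \<in># p"
      using not_less_Least[of "k - 1" "\<lambda>i. 0 < i \<and> i \<notin># p"] p assms
      by (auto simp: min_missing_def)
    hence "k - 1 \<le> \<Sum>\<^sub># p" by (simp add: sum_mset.remove)
    thus False using p assms by (simp add: partitions_def)
  qed
  hence "{p \<in> partitions n. min_missing p = k \<and>
            size {#i \<in># p. i > k#} > size {#i \<in># p. i < k#}} = {}"
    by blast
  thus ?thesis unfolding M_count_def by (metis card.empty)
qed

lemma neg_one_power_mult_nth:
  "fps_nth ((- 1) ^ i * f) n = (- 1) ^ i * fps_nth (f :: rat fps) n"
  by (cases "even i") auto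

lemma summable_M_gf: "(\<lambda>j. (-1) ^ (j + 1) * M_gf (2 * j)) summable_on {1..}"
proof (rule summable_on_fpsI)
  fix n
  have "{j \<in> {1..}. fps_nth ((-1) ^ (j + 1) * M_gf (2 * j)) n \<noteq> 0} \<subseteq> {..n + 1}"
  proof (intro subsetI, rule ccontr)
    fix j
    assume j: "j \<in> {j \<in> {1..}. fps_nth ((-1) ^ (j + 1) * M_gf (2 * j)) n \<noteq> 0}" "j \<notin> {..n + 1}"
    hence "M_count (2 * j) n = 0" by (intro M_count_eq_0) auto
    with j show False by (simp only: neg_one_power_mult_nth M_gf_def) simp
  qed
  thus "finite {j \<in> {1..}. fps_nth ((-1) ^ (j + 1) * M_gf (2 * j)) n \<noteq> 0}"
    by (rule finite_subset) auto
qed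

lemma qq_nth_0: "fps_nth (qq n) 0 = 1"
  proof (induction n)
  case (Suc n)
  have "qq (Suc n) = qq n * (1 - fps_X ^ Suc n)" by (simp add: qq_def mult.commute)
  with Suc show ?case by simp
qed (simp add: qq_def)

lemma fps_divide_qq: "f / qq n = f * inverse (qq n)"
  by (rule fps_divide_unit) (simp add: qq_nth_0)

lemma fps_X_power_dvd_term: "fps_X ^ n dvd fps_X ^ (a + (k + 1) * n) / qq n * g"
  unfolding fps_divide_qq by (intro dvd_mult2 le_imp_power_dvd) simp

lemma summable_inner:
  "(\<lambda>n. fps_X ^ (a + (k + 1) * n) / qq n * qbinom (n - 1) r) summable_on {m..}"
proof (rule summable_on_fpsI)
  fix i
  have "{n \<in> {m..}. fps_nth (fps_X ^ (a + (k + 1) * n) / qq n * qbinom (n - 1) r) i \<noteq> 0} \<subseteq> {..i}"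
    using fps_X_power_dvd_nth_0[OF fps_X_power_dvd_term] by (fastforce simp: not_less[symmetric])
  thus "finite {n \<in> {m..}. fps_nth (fps_X ^ (a + (k + 1) * n) / qq n * qbinom (n - 1) r) i \<noteq> 0}"
    by (rule finite_subset) auto
qed

lemma summable_outer:
  "(\<lambda>j. (-1) ^ (j + 1) *
     (\<Sum>\<^sub>\<infinity>n\<in>{2 * j..}. fps_X ^ ((2 * j choose 2) + (2 * j + 1) * n) / qq n *
        qbinom (n - 1) (2 * j - 1))) summable_on {1..}"
  (is "(\<lambda>j. (-1) ^ (j + 1) * ?S j) summable_on _")
proof (rule summable_on_fpsI)
  fix i
  have "fps_nth (?S j) i = 0" if "i < j" for j
  proof -
    have "fps_nth (fps_X ^ ((2 * j choose 2) + (2 * j + 1) * n) / qq n *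
            qbinom (n - 1) (2 * j - 1)) i = 0" if "n \<ge> 2 * j" for n
      using fps_X_power_dvd_nth_0[OF fps_X_power_dvd_term] that \<open>i < j\<close> by simp
    thus ?thesis
      using has_sum_fpsD(2)[OF has_sum_infsum[OF summable_inner[of "2 * j choose 2" "2 * j"
          "2 * j - 1" "2 * j"]], of i]
      by (auto intro!: sum.neutral)
  qed
  hence "{j \<in> {1..}. fps_nth ((-1) ^ (j + 1) * ?S j) i \<noteq> 0} \<subseteq> {..i}"
    by (auto simp only: neg_one_power_mult_nth) (force simp: not_less[symmetric])
  thus "finite {j \<in> {1..}. fps_nth ((-1) ^ (j + 1) * ?S j) i \<noteq> 0}"
    by (rule finite_subset) auto
qed

lemma summable_false_theta:
  fixes A :: "int set"
  shows "(\<lambda>n. (- (fps_X ^ 2)) ^ nat (n * (n + 1) div 2) *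
            (fps_X :: rat fps) ^ nat (n * (n - 1) div 2)) summable_on A"
    (is "?F summable_on A")
proof (rule summable_on_fpsI)
  fix i :: nat
  have dvd: "fps_X ^ (nat (n * (n + 1) div 2) + nat (n * (n - 1) div 2)) dvd ?F n" for n
  proof -
    have "(fps_X :: rat fps) ^ nat (n * (n + 1) div 2) dvd (- (fps_X ^ 2)) ^ nat (n * (n + 1) div 2)"
      by (intro dvd_power_same) (simp add: power2_eq_square)
    thus ?thesis by (simp add: power_add mult_dvd_mono)
  qed
  have exponent: "nat \<bar>n\<bar> \<le> nat (n * (n + 1) div 2) + nat (n * (n - 1) div 2)" for n :: int
  proof -
    have "n * (n + 1) div 2 + n * (n - 1) div 2 = n * n"
    proof -
      have "even (n * (n + 1))" "even (n * (n - 1))" by auto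
      hence "2 * (n * (n + 1) div 2 + n * (n - 1) div 2) = n * (n + 1) + n * (n - 1)"
        by simp
      also have "\<dots> = 2 * (n * n)" by (simp add: algebra_simps)
      finally show ?thesis
        by (rule mult_left_cancel[THEN iffD1, rotated]) simp
    qed
    moreover have "\<bar>n\<bar> \<le> n * n"
      using mult_right_mono[of 1 "\<bar>n\<bar>" "\<bar>n\<bar>"] by (cases "n = 0") (auto simp: abs_mult_self_eq)
    ultimately show ?thesis by linarith
  qed
  have "{n \<in> A. fps_nth (?F n) i \<noteq> 0} \<subseteq> {- int i..int i}"
  proof (intro subsetI, rule ccontr)
    fix n assume n: "n \<in> {n \<in> A. fps_nth (?F n) i \<noteq> 0}" "n \<notin> {- int i..int i}"
    hence "i < nat \<bar>n\<bar>" by auto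
    with exponent[of n] have "i < nat (n * (n + 1) div 2) + nat (n * (n - 1) div 2)" by linarith
    from fps_X_power_dvd_nth_0[OF dvd this] n show False by simp
  qed
  thus "finite {n \<in> A. fps_nth (?F n) i \<noteq> 0}"
    by (rule finite_subset) auto
qed

lemma qq_inf_has_prod: "(\<lambda>k. 1 - fps_X ^ Suc k) has_prod qq_inf"
proof -
  define P :: "nat \<Rightarrow> rat fps" where "P n = (\<Prod>k\<le>n. 1 - fps_X ^ Suc k)" for n
  define L where "L = Abs_fps (\<lambda>i. fps_nth (P i) i)"
  have step: "fps_nth (P (Suc n)) i = fps_nth (P n) i" if "i \<le> n" for i n
    using that fps_X_power_dvd_nth_0[of "Suc (Suc n)" "P n * fps_X ^ Suc (Suc n)" i]
    by (simp add: P_def algebra_simps del: power_Suc)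
  have const: "fps_nth (P (i + d)) i = fps_nth (P i) i" for i d
    by (induction d) (simp_all add: step)
  have lim: "P \<longlonglongrightarrow> L"
  proof (rule tendsto_fpsI)
    fix i
    show "eventually (\<lambda>n. fps_nth (P n) i = fps_nth L i) sequentially"
      using eventually_ge_at_top[of i]
      by eventually_elim (metis L_def const fps_nth_Abs_fps le_add_diff_inverse)
  qed
  have "fps_nth L 0 = 1" by (simp add: L_def P_def)
  hence "L \<noteq> 0" by auto
  with lim have "raw_has_prod (\<lambda>k. 1 - fps_X ^ Suc k) 0 L"
    unfolding raw_has_prod_def P_def[abs_def] add_0_right by blast
  hence *: "(\<lambda>k. 1 - fps_X ^ Suc k) has_prod L"
    unfolding has_prod_def by (rule disjI1)
  have "qq_inf = L"
    unfolding qq_inf_def prodinf_def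
    by (rule the_equality[where P = "\<lambda>p. (\<lambda>k. 1 - fps_X ^ Suc k) has_prod p"]) (use * has_prod_unique2 in blast)+
  with * show ?thesis by simp
qed

end

theory Submission
  imports Defs
begin

text \<open>
  Sorting a partition counted by \<open>\<M>\<^sub>k\<close> into its \<open>n\<close> parts above \<open>k\<close> and its parts below \<open>k\<close> gives
  the Andrews--Merca series. By the \<open>q\<close>-Pascal rule and Euler's sum for \<open>1 / (z; q)\<^sub>\<infinity>\<close>, that series satisfies
  \<open>(q; q)\<^sub>\<infinity> (\<M>\<^sub>k + \<M>\<^sub>k\<^sub>+\<^sub>1) = q\<^bsup>k(3k+1)/2\<^esup> (1 - q\<^bsup>2k+1\<^esup>)\<close>. Up to sign, the right-hand side is the sum of the terms
  of the false theta series with indices \<open>k\<close> and \<open>-k-1\<close>; the signs have period 4 in \<open>k\<close>, so the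
  partial sums telescope to \<open>(q; q)\<^sub>\<infinity>\<close> times 1 minus twice the alternating sum of the \<open>\<M>\<^sub>2\<^sub>j\<close>, up to a boundary term
  \<open>(q; q)\<^sub>\<infinity> \<M>\<^sub>2\<^sub>J\<close> that tends to 0.
\<close>

section \<open>The coefficientwise topology on power series\<close>

text \<open>Eventual agreement in each coefficient is preserved by addition; this makes
  \<open>has_sum_add\<close> and \<open>tendsto_add\<close> available for power series.\<close>

instance fps :: (ab_group_add) topological_comm_monoid_add
proof
  fix a b :: "'a fps"
  show "LIM x (nhds a \<times>\<^sub>F nhds b). fst x + snd x :> nhds (a + b)"
  proof (rule tendsto_fpsI)
    fix n
    have ev: "\<forall>\<^sub>F x in nhds c. fps_nth x n = fps_nth c n" for c :: "'a fps"
      using tendsto_fps_iff[of "\<lambda>x. x" c "nhds c"] by (simp add: filterlim_def)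
    hence "\<forall>\<^sub>F x in nhds a \<times>\<^sub>F nhds b. fps_nth (fst x) n = fps_nth a n \<and> fps_nth (snd x) n = fps_nth b n"
      by (intro eventually_prodI ev)
    thus "\<forall>\<^sub>F x in nhds a \<times>\<^sub>F nhds b. fps_nth (fst x + snd x) n = fps_nth (a + b) n"
      by eventually_elim simp
  qed
qed

text \<open>Coefficient \<open>n\<close> of a product depends only on the coefficients up to
  \<open>n\<close> of the factors, so finitely many eventual equalities suffice.\<close>

instance fps :: (ring) topological_semigroup_mult
proof
  fix a b :: "'a fps"
  show "LIM x (nhds a \<times>\<^sub>F nhds b). fst x * snd x :> nhds (a * b)"
  proof (rule tendsto_fpsI)
    fix n
    have ev: "\<forall>\<^sub>F x in nhds c. \<forall>i\<in>{..n}. fps_nth x i = fps_nth c i" for c :: "'a fps"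
      using tendsto_fps_iff[of "\<lambda>x. x" c "nhds c"]
      by (subst eventually_ball_finite_distrib) (simp_all add: filterlim_def)
    have "\<forall>\<^sub>F x in nhds a \<times>\<^sub>F nhds b.
            (\<forall>i\<in>{..n}. fps_nth (fst x) i = fps_nth a i) \<and> (\<forall>i\<in>{..n}. fps_nth (snd x) i = fps_nth b i)"
      by (intro eventually_prodI ev)
    thus "\<forall>\<^sub>F x in nhds a \<times>\<^sub>F nhds b. fps_nth (fst x * snd x) n = fps_nth (a * b) n"
      by eventually_elim (simp add: fps_mult_nth)
  qed
qed

text \<open>The intervals \<open>{m..<n}\<close> are cofinal among the finite subsets of
  \<open>{m..}\<close>. This turns unordered sums into sequential limits, to which the telescoped
  partial sums apply.\<close>

lemma has_sum_partial_sums: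
  fixes S :: "'b :: {comm_monoid_add, topological_space}"
  assumes "(g has_sum S) {m::nat..}"
  shows "(\<lambda>n. \<Sum>k\<in>{m..<n}. g k) \<longlonglongrightarrow> S"
proof -
  have "filterlim (\<lambda>n. {m..<n}) (finite_subsets_at_top {m..}) sequentially"
    unfolding filterlim_finite_subsets_at_top
  proof safe
    fix X assume X: "finite X" "X \<subseteq> {m..}"
    show "\<forall>\<^sub>F n in sequentially. finite {m..<n} \<and> X \<subseteq> {m..<n} \<and> {m..<n} \<subseteq> {m..}"
      \<comment> \<open>For empty \<open>X\<close> the value of \<open>Max X\<close> is unspecified,
        but the inclusion is then trivial.\<close>
      using eventually_gt_at_top[of "Max X"]
      by eventually_elim (use X in \<open>auto intro: le_less_trans[OF Max_ge]\<close>)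
  qed
  with assms show ?thesis
    unfolding has_sum_def by (rule filterlim_compose)
qed

section \<open>Generating functions of families of multisets\<close>

definition level :: "nat multiset set \<Rightarrow> nat \<Rightarrow> nat multiset set" where
  "level A n = {p \<in> A. \<Sum>\<^sub># p = n}"

text \<open>On an infinite level \<open>card\<close> would silently give 0, so the rules below
  control finiteness in every weight.\<close>

definition multiset_gf :: "nat multiset set \<Rightarrow> rat fps" where
  "multiset_gf A = Abs_fps (\<lambda>n. of_nat (card (level A n)))"

lemma multiset_gf_nth [simp]: "fps_nth (multiset_gf A) n = of_nat (card (level A n))"
  by (simp add: multiset_gf_def)

lemma level_subset: "A \<subseteq> B \<Longrightarrow> level A n \<subseteq> level B n"
  by (auto simp: level_def)

text \<open>The levels of the \<open>A n\<close> partition a finite level of the union, so only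
  finitely many \<open>n\<close> contribute in each degree.\<close>

lemma has_sum_multiset_gf:
  assumes fin: "\<And>i. finite (level (\<Union>n\<in>I. A n) i)" and disj: "disjoint_family_on A I"
  shows "((\<lambda>n. multiset_gf (A n)) has_sum multiset_gf (\<Union>n\<in>I. A n)) I"
proof (rule has_sum_fpsI)
  fix i
  define B where "B = {n\<in>I. level (A n) i \<noteq> {}}"
  have fin': "finite (level (A n) i)" if "n \<in> I" for n
    using that by (intro finite_subset[OF level_subset fin]) auto
  have B: "{n\<in>I. fps_nth (multiset_gf (A n)) i \<noteq> 0} = B"
    using fin' by (auto simp: B_def card_gt_0_iff)
  have disj': "disjoint_family_on (\<lambda>n. level (A n) i) B"
    using disj unfolding disjoint_family_on_def B_def level_def by blast
  have UN: "level (\<Union>n\<in>I. A n) i = (\<Union>n\<in>B. level (A n) i)"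
    by (auto simp: level_def B_def)
  have some: "(SOME p. p \<in> level (A n) i) \<in> level (A n) i" if "n \<in> B" for n
    using that by (simp add: B_def some_in_eq)
  \<comment> \<open>Picking one element from each nonempty level injects \<open>B\<close> into the
    finite level of the union.\<close>
  have "finite B"
  proof (rule inj_on_finite)
    show "(\<lambda>n. SOME p. p \<in> level (A n) i) ` B \<subseteq> level (\<Union>n\<in>I. A n) i"
      unfolding UN using some by blast
    show "inj_on (\<lambda>n. SOME p. p \<in> level (A n) i) B"
    proof (rule inj_onI, rule ccontr)
      fix m n assume mn: "m \<in> B" "n \<in> B"
        and eq: "(SOME p. p \<in> level (A m) i) = (SOME p. p \<in> level (A n) i)" and neq: "m \<noteq> n"
      show False
        using some[OF mn(1)] some[OF mn(2)] eq disjoint_family_onD[OF disj' mn neq] by auto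
    qed
  qed (rule fin)
  thus "finite {n\<in>I. fps_nth (multiset_gf (A n)) i \<noteq> 0}"
    by (simp only: B)
  have "card (level (\<Union>n\<in>I. A n) i) = (\<Sum>n\<in>B. card (level (A n) i))"
    unfolding UN
    by (rule card_UN_disjoint)
       (use \<open>finite B\<close> fin' disj' in \<open>auto simp: B_def disjoint_family_on_def\<close>)
  thus "fps_nth (multiset_gf (\<Union>n\<in>I. A n)) i =
          (\<Sum>n | n \<in> I \<and> fps_nth (multiset_gf (A n)) i \<noteq> 0. fps_nth (multiset_gf (A n)) i)"
    unfolding B by simp
qed

lemma multiset_gf_Un:
  assumes "\<And>i. finite (level A i)" "\<And>i. finite (level B i)" "A \<inter> B = {}"
  shows "multiset_gf (A \<union> B) = multiset_gf A + multiset_gf B"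
proof (rule fps_ext)
  fix i
  have "level (A \<union> B) i = level A i \<union> level B i" "level A i \<inter> level B i = {}"
    using assms(3) by (auto simp: level_def)
  thus "fps_nth (multiset_gf (A \<union> B)) i = fps_nth (multiset_gf A + multiset_gf B) i"
    using assms by (simp add: card_Un_disjoint)
qed

lemma level_plus:
  "level ((\<lambda>(a, b). a + b) ` (A \<times> B)) i =
     (\<lambda>(a, b). a + b) ` (\<Union>j\<in>{0..i}. level A j \<times> level B (i - j))"
proof (intro equalityI subsetI)
  fix p assume "p \<in> level ((\<lambda>(a, b). a + b) ` (A \<times> B)) i"
  then obtain a b where "a \<in> A" "b \<in> B" "p = a + b" "\<Sum>\<^sub># a + \<Sum>\<^sub># b = i"
    by (auto simp: level_def)
  thus "p \<in> (\<lambda>(a, b). a + b) ` (\<Union>j\<in>{0..i}. level A j \<times> level B (i - j))"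
    by (auto simp: level_def intro!: image_eqI[of _ _ "(a, b)"])
qed (auto simp: level_def)

lemma finite_level_plus:
  assumes "\<And>i. finite (level A i)" "\<And>i. finite (level B i)"
  shows "finite (level ((\<lambda>(a, b). a + b) ` (A \<times> B)) i)"
  unfolding level_plus using assms by auto

text \<open>Weights add under multiset union, so levels convolve like the coefficients of a Cauchy
  product; injectivity makes each splitting count once.\<close>

lemma multiset_gf_plus:
  assumes "\<And>i. finite (level A i)" "\<And>i. finite (level B i)"
    and inj: "inj_on (\<lambda>(a, b). a + b) (A \<times> B)"
  shows "multiset_gf ((\<lambda>(a, b). a + b) ` (A \<times> B)) = multiset_gf A * multiset_gf B"
proof (rule fps_ext)
  fix i
  have "card (level ((\<lambda>(a, b). a + b) ` (A \<times> B)) i) = card (\<Union>j\<in>{0..i}. level A j \<times> level B (i - j))"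
    unfolding level_plus
    by (rule card_image, rule inj_on_subset[OF inj]) (auto simp: level_def)
  also have "\<dots> = (\<Sum>j=0..i. card (level A j \<times> level B (i - j)))"
    by (rule card_UN_disjoint) (use assms(1,2) in \<open>auto simp: level_def\<close>)
  finally show "fps_nth (multiset_gf ((\<lambda>(a, b). a + b) ` (A \<times> B))) i =
                  fps_nth (multiset_gf A * multiset_gf B) i"
    by (simp add: fps_mult_nth card_cartesian_product)
qed

lemma multiset_gf_singleton: "multiset_gf {p} = fps_X ^ (\<Sum>\<^sub># p)"
proof (rule fps_ext)
  fix i
  have "level {p} i = (if \<Sum>\<^sub># p = i then {p} else {})"
    by (auto simp: level_def)
  thus "fps_nth (multiset_gf {p}) i = fps_nth (fps_X ^ (\<Sum>\<^sub># p)) i"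
    by auto
qed

lemma finite_level_translate:
  assumes "\<And>i. finite (level A i)"
  shows "finite (level ((+) p ` A) i)"
proof -
  have "(+) p ` A = (\<lambda>(a, b). a + b) ` ({p} \<times> A)" by auto
  thus ?thesis
    using finite_level_plus[OF _ assms, of "{p}"] by (simp add: level_def)
qed

lemma multiset_gf_translate:
  assumes "\<And>i. finite (level A i)"
  shows "multiset_gf ((+) p ` A) = fps_X ^ (\<Sum>\<^sub># p) * multiset_gf A"
proof -
  have "(+) p ` A = (\<lambda>(a, b). a + b) ` ({p} \<times> A)" by auto
  thus ?thesis
    using multiset_gf_plus[OF _ assms, of "{p}"]
    by (simp add: level_def multiset_gf_singleton inj_on_def)
qed

section \<open>Partitions with bounded parts\<close>

lemma qq_Suc: "qq (Suc n) = qq n * (1 - fps_X ^ Suc n)"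
  by (simp add: qq_def mult.commute)

lemma qq_0 [simp]: "qq 0 = 1"
  by (simp add: qq_def)

lemma qq_mult_inverse [simp]: "qq n * inverse (qq n) = 1"
  by (rule inverse_mult_eq_1') (simp add: qq_nth_0)

lemma qq_nonzero [simp]: "qq n \<noteq> 0"
  using qq_nth_0[of n] by auto

lemma inverse_qq_Suc: "inverse (qq (Suc n)) * (1 - fps_X ^ Suc n) = inverse (qq n)"
proof -
  have "qq (Suc n) * (inverse (qq (Suc n)) * (1 - fps_X ^ Suc n)) = qq (Suc n) * inverse (qq n)"
  proof -
    have "qq (Suc n) * (inverse (qq (Suc n)) * (1 - fps_X ^ Suc n)) = 1 - fps_X ^ Suc n"
      by (simp only: mult.assoc[symmetric] qq_mult_inverse mult_1_left)
    also have "\<dots> = qq n * inverse (qq n) * (1 - fps_X ^ Suc n)"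
      by simp
    also have "\<dots> = qq (Suc n) * inverse (qq n)"
      by (simp only: qq_Suc ac_simps)
    finally show ?thesis .
  qed
  thus ?thesis by simp
qed

lemma inverse_qq: "inverse (qq n) = inverse (qq (Suc n)) * (1 - fps_X ^ Suc n)"
  by (simp only: inverse_qq_Suc)

text \<open>Writing the upper index as \<open>a + b\<close> avoids both subtraction and the side
  condition \<open>r \<le> m\<close>.\<close>

lemma qbinom_add: "qbinom (a + b) a = qq (a + b) * inverse (qq a) * inverse (qq b)"
proof -
  have "qbinom (a + b) a = qq (a + b) * inverse (qq a * qq b)"
    unfolding qbinom_def by (subst fps_divide_unit) (simp_all add: qq_nth_0)
  thus ?thesis by (simp add: fps_inverse_mult ac_simps)
qed

lemma qbinom_0_right [simp]: "qbinom n 0 = 1"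
  using qbinom_add[of 0 n] by simp

lemma qbinom_same [simp]: "qbinom n n = 1"
  using qbinom_add[of n 0] by simp

lemma qbinom_Pascal:
  "qbinom (Suc a + Suc b) (Suc a) =
     qbinom (a + Suc b) a + fps_X ^ Suc a * qbinom (Suc a + b) (Suc a)"
proof -
  define u v where "u = inverse (qq (Suc a))" and "v = inverse (qq (Suc b))"
  define x y where "x = (fps_X :: rat fps) ^ Suc a" and "y = (fps_X :: rat fps) ^ Suc b"
  have "qq (Suc (Suc (a + b))) = qq (Suc (a + b)) * (1 - x * y)"
    by (simp add: qq_Suc[of "Suc (a + b)"] x_def y_def power_add mult_ac)
  hence "qbinom (Suc a + Suc b) (Suc a) = qq (Suc (a + b)) * (1 - x * y) * u * v"
    using qbinom_add[of "Suc a" "Suc b"] by (simp add: u_def v_def)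
  \<comment> \<open>The q-Pascal rule comes down to
    \<open>1 - x y = (1 - x) + x (1 - y)\<close>.\<close>
  also have "\<dots> = qq (Suc (a + b)) * (u * (1 - x)) * v + x * (qq (Suc (a + b)) * u * (v * (1 - y)))"
    by (simp add: algebra_simps)
  also have "u * (1 - x) = inverse (qq a)"
    by (simp only: u_def x_def inverse_qq_Suc)
  also have "v * (1 - y) = inverse (qq b)"
    by (simp only: v_def y_def inverse_qq_Suc)
  finally show ?thesis
    using qbinom_add[of a "Suc b"] qbinom_add[of "Suc a" b] by (simp add: u_def v_def x_def)
qed

section \<open>Multisets with a fixed number of parts bounded below\<close>

definition parts_ge :: "nat \<Rightarrow> nat \<Rightarrow> nat multiset set" where
  "parts_ge n k = {p. size p = n \<and> (\<forall>x\<in>#p. k \<le> x)}"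

lemma mem_le_sum_mset: "x \<in># p \<Longrightarrow> x \<le> \<Sum>\<^sub># (p :: nat multiset)"
  by (simp add: sum_mset.remove)

lemma finite_level_parts_ge: "finite (level (parts_ge n k) i)"
proof (rule finite_subset)
  show "level (parts_ge n k) i \<subseteq> multisets_of_size {..i} n"
    using mem_le_sum_mset by (auto simp: level_def parts_ge_def multisets_of_size_def)
qed auto

lemma parts_ge_0 [simp]: "parts_ge 0 k = {{#}}"
  by (auto simp: parts_ge_def)

lemma parts_ge_Suc_right: "parts_ge n (Suc k) = image_mset Suc ` parts_ge n k"
proof (intro equalityI subsetI)
  fix p assume p: "p \<in> parts_ge n (Suc k)"
  have "p = image_mset Suc (image_mset (\<lambda>x. x - 1) p)"
  proof -
    have "image_mset (\<lambda>x. Suc (x - 1)) p = image_mset (\<lambda>x. x) p"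
      using p by (intro image_mset_cong) (auto simp: parts_ge_def)
    thus ?thesis by (simp add: multiset.map_comp o_def)
  qed
  moreover have "image_mset (\<lambda>x. x - 1) p \<in> parts_ge n k"
    using p by (force simp: parts_ge_def)
  ultimately show "p \<in> image_mset Suc ` parts_ge n k" by blast
qed (auto simp: parts_ge_def)

text \<open>Raising each of the \<open>n\<close> parts by one is a bijection that adds
  \<open>n\<close> to the weight.\<close>

lemma multiset_gf_parts_ge_Suc_right:
  "multiset_gf (parts_ge n (Suc k)) = fps_X ^ n * multiset_gf (parts_ge n k)"
proof (rule fps_ext)
  fix i
  have sum: "\<Sum>\<^sub># (image_mset Suc p) = \<Sum>\<^sub># p + size p" for p
    by (induction p) auto
  have lev: "level (parts_ge n (Suc k)) i =
               (if i < n then {} else image_mset Suc ` level (parts_ge n k) (i - n))"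
    unfolding parts_ge_Suc_right by (auto simp: level_def sum parts_ge_def)
  have "inj_on (image_mset Suc) X" for X
    by (rule inj_on_subset[OF multiset.inj_map]) auto
  thus "fps_nth (multiset_gf (parts_ge n (Suc k))) i = fps_nth (fps_X ^ n * multiset_gf (parts_ge n k)) i"
    unfolding lev multiset_gf_nth fps_X_power_mult_nth by (simp add: card_image)
qed

text \<open>Either all parts exceed \<open>k\<close>, or one copy of \<open>k\<close> can be
  removed. With \<open>G n\<close> for the series this reads
  \<open>G (n+1) = q^(n+1) G (n+1) + q^k G n\<close>, which is solved for
  \<open>G (n+1)\<close>.\<close>

lemma multiset_gf_parts_ge: "multiset_gf (parts_ge n k) = fps_X ^ (k * n) * inverse (qq n)"
proof (induction n)
  case 0
  show ?case by (simp add: multiset_gf_singleton)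
next
  case (Suc n)
  have "parts_ge (Suc n) k = parts_ge (Suc n) (Suc k) \<union> (+) {#k#} ` parts_ge n k"
  proof (intro equalityI subsetI)
    fix p assume p: "p \<in> parts_ge (Suc n) k"
    show "p \<in> parts_ge (Suc n) (Suc k) \<union> (+) {#k#} ` parts_ge n k"
    proof (cases "k \<in># p")
      case True
      then obtain r where "p = add_mset k r" by (meson mset_add)
      with p show ?thesis by (auto simp: parts_ge_def)
    next
      case False
      with p show ?thesis by (auto simp: parts_ge_def Suc_le_eq le_less)
    qed
  qed (auto simp: parts_ge_def)
  moreover have "parts_ge (Suc n) (Suc k) \<inter> (+) {#k#} ` parts_ge n k = {}"
    by (auto simp: parts_ge_def)
  ultimately have "multiset_gf (parts_ge (Suc n) k) =
      fps_X ^ Suc n * multiset_gf (parts_ge (Suc n) k) + fps_X ^ k * multiset_gf (parts_ge n k)"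
    by (metis multiset_gf_Un[OF finite_level_parts_ge finite_level_translate[OF finite_level_parts_ge]]
         multiset_gf_translate[OF finite_level_parts_ge] multiset_gf_parts_ge_Suc_right sum_mset.singleton)
  hence "multiset_gf (parts_ge (Suc n) k) * (1 - fps_X ^ Suc n) = fps_X ^ k * multiset_gf (parts_ge n k)"
    by (simp only: algebra_simps mult_1_left)
  also have "\<dots> = fps_X ^ (k * Suc n) * inverse (qq (Suc n)) * (1 - fps_X ^ Suc n)"
    unfolding Suc.IH inverse_qq[of n] by (simp only: power_add mult_Suc_right mult.assoc)
  finally have "(multiset_gf (parts_ge (Suc n) k) - fps_X ^ (k * Suc n) * inverse (qq (Suc n))) *
      (1 - fps_X ^ Suc n) = 0"
    by (simp only: left_diff_distrib diff_self)
  moreover have "fps_nth (1 - fps_X ^ Suc n :: rat fps) 0 = 1" by simp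
  hence "1 - fps_X ^ Suc n \<noteq> (0 :: rat fps)" by (metis fps_zero_nth zero_neq_one)
  ultimately show ?case by (simp only: mult_eq_0_iff) simp
qed

section \<open>Partitions inside a box\<close>

definition parts_box :: "nat \<Rightarrow> nat \<Rightarrow> nat multiset set" where
  "parts_box j m = {p. set_mset p \<subseteq> {1..j} \<and> size p \<le> m}"

lemma finite_parts_box: "finite (parts_box j m)"
proof (rule finite_subset)
  show "parts_box j m \<subseteq> (\<Union>i\<le>m. multisets_of_size {1..j} i)"
    by (auto simp: parts_box_def multisets_of_size_def)
qed auto

lemma finite_level_parts_box: "finite (level (parts_box j m) i)"
  using finite_parts_box by (simp add: level_def)

text \<open>Splitting on whether the largest allowed part \<open>j\<close> occurs reproduces the
  q-Pascal rule. Each of the two smaller boxes shrinks only one side, hence the induction on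
  \<open>j + m\<close>.\<close>

lemma multiset_gf_parts_box: "multiset_gf (parts_box j m) = qbinom (j + m) j"
proof (induction "j + m" arbitrary: j m rule: less_induct)
  case less
  show ?case
  proof (cases "j = 0 \<or> m = 0")
    case True
    hence "parts_box j m = {{#}}" by (auto simp: parts_box_def)
    moreover have "qbinom (j + m) j = 1" using True by auto
    ultimately show ?thesis by (simp add: multiset_gf_singleton)
  next
    case False
    then obtain a b where ab: "j = Suc a" "m = Suc b"
      by (metis not0_implies_Suc)
    have "parts_box j m = parts_box a m \<union> (+) {#j#} ` parts_box j b"
    proof (intro equalityI subsetI)
      fix p assume p: "p \<in> parts_box j m"
      show "p \<in> parts_box a m \<union> (+) {#j#} ` parts_box j b"
      proof (cases "j \<in># p")
        case True
        then obtain r where "p = add_mset j r" by (meson mset_add)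
        with p ab show ?thesis by (auto simp: parts_box_def)
      next
        case False
        hence "set_mset p \<subseteq> {1..j} - {j}" using p by (auto simp: parts_box_def)
        also have "\<dots> = {1..a}" using ab by auto
        finally show ?thesis using p by (auto simp: parts_box_def)
      qed
    qed (use ab in \<open>auto simp: parts_box_def\<close>)
    moreover have "parts_box a m \<inter> (+) {#j#} ` parts_box j b = {}"
      using ab by (auto simp: parts_box_def)
    ultimately have "multiset_gf (parts_box j m) =
        multiset_gf (parts_box a m) + fps_X ^ j * multiset_gf (parts_box j b)"
      by (metis multiset_gf_Un[OF finite_level_parts_box finite_level_translate[OF finite_level_parts_box]]
           multiset_gf_translate[OF finite_level_parts_box] sum_mset.singleton)
    thus ?thesis
      using less[of a m] less[of j b] qbinom_Pascal[of a b] ab by simp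
  qed
qed

section \<open>The parts below the least missing part\<close>

definition full_below :: "nat \<Rightarrow> nat \<Rightarrow> nat multiset set" where
  "full_below k n = {p. set_mset p = {1..<k} \<and> size p < n}"

text \<open>Removing one copy of each of \<open>1, ..., k - 1\<close> leaves parts of size at most
  \<open>k - 1\<close>, and at most \<open>(n - 1) - (k - 1) = n - k\<close> of them.\<close>

lemma full_below_eq:
  assumes "1 \<le> k" "k \<le> n"
  shows "full_below k n = (+) (mset_set {1..<k}) ` parts_box (k - 1) (n - k)"
proof (intro equalityI subsetI)
  fix p assume p: "p \<in> full_below k n"
  have sub: "mset_set {1..<k} \<subseteq># p"
    using p by (auto simp: full_below_def subseteq_mset_def count_mset_set' Suc_le_eq)
  then obtain r where r: "p = mset_set {1..<k} + r"
    by (auto simp: mset_subset_eq_exists_conv)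
  have "set_mset r \<subseteq> {1..<k}"
    using p r by (auto simp: full_below_def)
  moreover have "{1..<k} = {1..k - 1}" using assms by auto
  moreover have "size r \<le> n - k"
    using p r assms by (auto simp: full_below_def)
  ultimately have "r \<in> parts_box (k - 1) (n - k)"
    by (simp add: parts_box_def)
  with r show "p \<in> (+) (mset_set {1..<k}) ` parts_box (k - 1) (n - k)" by blast
next
  fix p assume "p \<in> (+) (mset_set {1..<k}) ` parts_box (k - 1) (n - k)"
  then obtain r where "p = mset_set {1..<k} + r" "set_mset r \<subseteq> {1..k - 1}" "size r \<le> n - k"
    by (auto simp: parts_box_def)
  thus "p \<in> full_below k n"
    using assms by (fastforce simp: full_below_def)
qed

lemma finite_level_full_below:
  assumes "1 \<le> k" "k \<le> n"
  shows "finite (level (full_below k n) i)"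
  unfolding full_below_eq[OF assms] by (rule finite_level_translate[OF finite_level_parts_box])

lemma multiset_gf_full_below:
  assumes "1 \<le> k" "k \<le> n"
  shows "multiset_gf (full_below k n) = fps_X ^ (k choose 2) * qbinom (n - 1) (k - 1)"
proof -
  obtain j where j: "k = Suc j" using assms by (metis Suc_pred' less_eq_Suc_le One_nat_def)
  have "\<Sum>\<^sub># (mset_set {1..<k}) = \<Sum>{1..<k}"
    by (simp add: sum_unfold_sum_mset)
  also have "\<dots> = k choose 2"
    unfolding j by (induction j) (simp_all add: numeral_2_eq_2)
  finally show ?thesis
    unfolding full_below_eq[OF assms] multiset_gf_translate[OF finite_level_parts_box] multiset_gf_parts_box
    using assms by simp
qed

section \<open>The Andrews--Merca formula\<close>

definition M_set :: "nat \<Rightarrow> nat multiset set" where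
  "M_set k = {p. 0 \<notin># p \<and> min_missing p = k \<and>
                 size {#i \<in># p. i > k#} > size {#i \<in># p. i < k#}}"

lemma M_gf_eq: "M_gf k = multiset_gf (M_set k)"
proof (rule fps_ext)
  fix i
  have "level (M_set k) i = {p \<in> partitions i. min_missing p = k \<and>
          size {#i \<in># p. i > k#} > size {#i \<in># p. i < k#}}"
    by (auto simp: level_def M_set_def partitions_def)
  thus "fps_nth (M_gf k) i = fps_nth (multiset_gf (M_set k)) i"
    by (simp add: M_gf_def M_count_def)
qed

lemma finite_level_M_set: "finite (level (M_set k) i)"
  by (rule finite_subset[OF _ finite_partitions[of i]]) (auto simp: level_def M_set_def partitions_def)

lemma min_missing_eq_iff:
  assumes "1 \<le> k"
  shows "min_missing p = k \<longleftrightarrow> {1..<k} \<subseteq> set_mset p \<and> k \<notin># p"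
proof
  assume k: "min_missing p = k"
  \<comment> \<open>The sum bounds all parts, so a larger positive number is missing and the
    \<open>LEAST\<close> in \<open>min_missing\<close> is attained.\<close>
  obtain m where "m > \<Sum>\<^sub># p" "0 < m" by (meson lessI zero_less_Suc gt_ex less_trans)
  hence "\<exists>i. 0 < i \<and> i \<notin># p" using mem_le_sum_mset by (metis leD)
  hence "k \<notin># p" using LeastI_ex[of "\<lambda>i. 0 < i \<and> i \<notin># p"] k by (simp add: min_missing_def)
  moreover have "i \<in># p" if "1 \<le> i" "i < k" for i
    using not_less_Least[of i "\<lambda>i. 0 < i \<and> i \<notin># p"] that k by (simp add: min_missing_def)
  ultimately show "{1..<k} \<subseteq> set_mset p \<and> k \<notin># p" by auto
next
  assume "{1..<k} \<subseteq> set_mset p \<and> k \<notin># p"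
  thus "min_missing p = k"
    unfolding min_missing_def using assms
    by (intro Least_equality) (auto simp: Suc_le_eq subset_iff not_less[symmetric])
qed

lemma filter_parts_ge:
  assumes "p \<in> parts_ge n (Suc k)"
  shows "{#i \<in># p. i > k#} = p" "{#i \<in># p. i < k#} = {#}"
  using assms by (auto simp: parts_ge_def filter_mset_eq_conv)

lemma filter_full_below:
  assumes "p \<in> full_below k n"
  shows "{#i \<in># p. i > k#} = {#}" "{#i \<in># p. i < k#} = p"
  using assms by (auto simp: full_below_def filter_mset_eq_conv)

text \<open>The absent value \<open>k\<close> cuts the partition into \<open>n\<close> larger parts
  and a remainder of fewer than \<open>n\<close> parts that uses exactly the sizes
  \<open>1, ..., k - 1\<close>.\<close>

lemma M_set_eq:
  assumes "1 \<le> k"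
  shows "M_set k = (\<Union>n\<in>{k..}. (\<lambda>(a, b). a + b) ` (parts_ge n (Suc k) \<times> full_below k n))"
proof (intro equalityI subsetI)
  fix p assume p: "p \<in> M_set k"
  define a b where "a = {#i \<in># p. i > k#}" and "b = {#i \<in># p. i < k#}"
  have 0: "0 \<notin># p" and sub: "{1..<k} \<subseteq> set_mset p" and k: "k \<notin># p" and less: "size b < size a"
    using p min_missing_eq_iff[OF assms, of p] by (auto simp: M_set_def a_def b_def)
  have "p = a + b"
    using k by (intro multiset_eqI) (auto simp: a_def b_def not_in_iff[symmetric] not_less dest: le_antisym)
  have set_b: "set_mset b = {1..<k}"
    using 0 sub by (auto simp: b_def Suc_le_eq intro: gr0I)
  \<comment> \<open>Each of the \<open>k - 1\<close> smaller values occurs, and the parts above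
    \<open>k\<close> are strictly more numerous; this is why the series starts at
    \<open>n = k\<close>.\<close>
  hence "k - 1 \<le> size b"
    by (metis card_atLeastLessThan mset_set_set_mset_msubset size_mset_mono size_mset_set)
  with less assms have "k \<le> size a" by linarith
  moreover have "a \<in> parts_ge (size a) (Suc k)"
    by (auto simp: parts_ge_def a_def)
  moreover have "b \<in> full_below k (size a)"
    using set_b less by (simp add: full_below_def)
  ultimately show "p \<in> (\<Union>n\<in>{k..}. (\<lambda>(a, b). a + b) ` (parts_ge n (Suc k) \<times> full_below k n))"
    using \<open>p = a + b\<close> by force
next
  fix p assume "p \<in> (\<Union>n\<in>{k..}. (\<lambda>(a, b). a + b) ` (parts_ge n (Suc k) \<times> full_below k n))"
  then obtain n a b where n: "k \<le> n" and a: "a \<in> parts_ge n (Suc k)" and b: "b \<in> full_below k n"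
    and p: "p = a + b"
    by auto
  have "min_missing p = k"
    unfolding min_missing_eq_iff[OF assms] using a b p by (auto simp: parts_ge_def full_below_def)
  moreover have "0 \<notin># p"
    using a b p by (auto simp: parts_ge_def full_below_def)
  moreover have "size {#i \<in># p. i > k#} > size {#i \<in># p. i < k#}"
    using a b by (simp add: p filter_parts_ge[OF a] filter_full_below[OF b])
       (simp add: parts_ge_def full_below_def)
  ultimately show "p \<in> M_set k"
    by (simp add: M_set_def)
qed

definition M_term :: "nat \<Rightarrow> nat \<Rightarrow> rat fps" where
  "M_term k n = fps_X ^ ((k choose 2) + (k + 1) * n) / qq n * qbinom (n - 1) (k - 1)"

text \<open>The parts above \<open>k\<close> contribute \<open>q^((k+1)n) / (q;q)_n\<close>, those
  below \<open>q^(k choose 2)\<close> times a q-binomial. Filtering at \<open>k\<close> recovers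
  both pieces and \<open>n\<close>, so nothing is counted twice.\<close>

lemma has_sum_M_gf:
  assumes "1 \<le> k"
  shows "(M_term k has_sum M_gf k) {k..}"
proof -
  let ?A = "\<lambda>n. (\<lambda>(a, b). a + b) ` (parts_ge n (Suc k) \<times> full_below k n)"
  have "((\<lambda>n. multiset_gf (?A n)) has_sum multiset_gf (\<Union>n\<in>{k..}. ?A n)) {k..}"
  proof (rule has_sum_multiset_gf)
    show "finite (level (\<Union>n\<in>{k..}. ?A n) i)" for i
      using finite_level_M_set[of k i] by (simp only: M_set_eq[OF assms])
    have "size {#i \<in># p. i > k#} = n" if "p \<in> ?A n" for p n
      using that by (auto simp: filter_parts_ge filter_full_below) (auto simp: parts_ge_def)
    thus "disjoint_family_on ?A {k..}"
      unfolding disjoint_family_on_def by blast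
  qed
  moreover have "multiset_gf (?A n) = M_term k n" if "k \<le> n" for n
  proof -
    have "inj_on (\<lambda>(a, b). a + b) (parts_ge n (Suc k) \<times> full_below k n)"
    proof (rule inj_on_inverseI[where g = "\<lambda>p. ({#i \<in># p. i > k#}, {#i \<in># p. i < k#})"])
      fix x assume "x \<in> parts_ge n (Suc k) \<times> full_below k n"
      thus "({#i \<in># (case x of (a, b) \<Rightarrow> a + b). i > k#}, {#i \<in># (case x of (a, b) \<Rightarrow> a + b). i < k#}) = x"
        by (auto simp: filter_parts_ge filter_full_below)
    qed
    from multiset_gf_plus[OF finite_level_parts_ge finite_level_full_below[OF assms that] this]
    show ?thesis
      unfolding multiset_gf_parts_ge multiset_gf_full_below[OF assms that] M_term_def fps_divide_qq power_add
      by (simp add: mult_ac)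
  qed
  ultimately show ?thesis
    unfolding M_gf_eq M_set_eq[OF assms] by (subst has_sum_cong[symmetric]) auto
qed

section \<open>Euler's sum for the reciprocal of the product\<close>

lemma fps_nth_euler_term_eq_0:
  assumes "n < k * m"
  shows "fps_nth (fps_X ^ (k * m) * inverse (qq m)) n = 0"
  using assms by (simp add: fps_X_power_mult_nth)

lemma summable_euler: "(\<lambda>m. fps_X ^ (Suc k * m) * inverse (qq m)) summable_on UNIV"
proof (rule summable_on_fpsI)
  fix n
  have "{m \<in> UNIV. fps_nth (fps_X ^ (Suc k * m) * inverse (qq m)) n \<noteq> 0} \<subseteq> {..n}"
    using fps_nth_euler_term_eq_0[of n "Suc k"] by (force simp: not_less[symmetric])
  thus "finite {m \<in> UNIV. fps_nth (fps_X ^ (Suc k * m) * inverse (qq m)) n \<noteq> 0}"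
    by (rule finite_subset) auto
qed

text \<open>Euler's series, the sum of \<open>z^m / (q;q)_m\<close>, at \<open>z = q^(k+1)\<close>.
  Its closed form \<open>1 / (z;q)_inf\<close> appears below with denominators cleared.\<close>

definition euler_sum :: "nat \<Rightarrow> rat fps" where
  "euler_sum k = (\<Sum>\<^sub>\<infinity>m. fps_X ^ (Suc k * m) * inverse (qq m))"

lemma has_sum_euler: "((\<lambda>m. fps_X ^ (Suc k * m) * inverse (qq m)) has_sum euler_sum k) UNIV"
  unfolding euler_sum_def by (rule has_sum_infsum[OF summable_euler])

text \<open>Zero padding at the front lets a shifted series be added termwise to an unshifted
  one.\<close>

lemma has_sum_Suc_shift:
  assumes "((f :: nat \<Rightarrow> 'a :: topological_comm_monoid_add) has_sum S) UNIV"
  shows "((\<lambda>n. if n = 0 then 0 else f (n - 1)) has_sum S) UNIV"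
proof -
  have "((\<lambda>n. f (n - 1)) has_sum S) (range Suc)"
    using assms by (subst has_sum_reindex) (simp_all add: o_def)
  thus ?thesis
    by (rule has_sum_cong_neutral[THEN iffD1, rotated -1]) (auto simp: image_iff gr0_conv_Suc)
qed

text \<open>This is \<open>E(z) = E(qz) + z E(z)\<close> for Euler's series at
  \<open>z = q^(k+1)\<close>. If \<open>c\<close> is the term of index \<open>m > 0\<close> on the
  left, the right contributes \<open>c q^m + c (1 - q^m)\<close>.\<close>

lemma euler_sum_rec: "euler_sum k = euler_sum (Suc k) + fps_X ^ Suc k * euler_sum k"
proof (rule has_sum_unique[OF has_sum_euler])
  let ?f = "\<lambda>k m. fps_X ^ (Suc k * m) * inverse (qq m) :: rat fps"
  have "((\<lambda>m. ?f (Suc k) m + (if m = 0 then 0 else fps_X ^ Suc k * ?f k (m - 1))) has_sum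
          (euler_sum (Suc k) + fps_X ^ Suc k * euler_sum k)) UNIV"
    by (intro has_sum_add has_sum_Suc_shift has_sum_cmult_right has_sum_euler)
  also have "(\<lambda>m. ?f (Suc k) m + (if m = 0 then 0 else fps_X ^ Suc k * ?f k (m - 1))) = ?f k"
  proof
    fix m
    show "?f (Suc k) m + (if m = 0 then 0 else fps_X ^ Suc k * ?f k (m - 1)) = ?f k m"
    proof (cases m)
      case (Suc l)
      define c where "c = ?f k m"
      have "fps_X ^ Suc k * ?f k l = c * (1 - fps_X ^ m)"
        unfolding c_def inverse_qq[of l] Suc by (simp add: power_add mult_ac)
      moreover have "?f (Suc k) m = c * fps_X ^ m"
        by (simp add: c_def power_add mult_ac)
      moreover have "c * fps_X ^ m + c * (1 - fps_X ^ m) = c"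
        by (simp add: algebra_simps)
      ultimately show ?thesis
        using Suc by (simp only: c_def nat.distinct if_False diff_Suc_1)
    qed simp
  qed
  finally show "(?f k has_sum (euler_sum (Suc k) + fps_X ^ Suc k * euler_sum k)) UNIV" .
qed

lemma euler_sum_eq: "euler_sum k = qq k * euler_sum 0"
proof (induction k)
  case (Suc k)
  have "euler_sum (Suc k) = (1 - fps_X ^ Suc k) * euler_sum k"
    using euler_sum_rec[of k] by (simp add: algebra_simps)
  thus ?case using Suc by (simp add: qq_Suc mult_ac)
qed simp

text \<open>In degree \<open>n \<le> k\<close> only the term \<open>m = 0\<close> survives, as the
  others have order at least \<open>k + 1\<close>.\<close>

lemma euler_sum_tendsto: "euler_sum \<longlonglongrightarrow> 1"
proof (rule tendsto_fpsI)
  fix n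
  show "\<forall>\<^sub>F k in sequentially. fps_nth (euler_sum k) n = fps_nth 1 n"
    using eventually_ge_at_top[of n]
  proof eventually_elim
    case (elim k)
    have *: "fps_nth (fps_X ^ (Suc k * m) * inverse (qq m)) n = (if m = 0 then fps_nth 1 n else 0)" for m
      using elim fps_nth_euler_term_eq_0[of n "Suc k" m] by (cases m) auto
    show ?case
      unfolding has_sum_fpsD(2)[OF has_sum_euler, of k n] * by (cases n) auto
  qed
qed

lemma qq_tendsto: "qq \<longlonglongrightarrow> qq_inf"
proof -
  have "(\<lambda>n. \<Prod>k\<le>n. 1 - fps_X ^ Suc k) \<longlonglongrightarrow> qq_inf"
    using qq_inf_has_prod by (rule has_prod_imp_tendsto)
  \<comment> \<open>The product up to index \<open>n\<close> has \<open>n + 1\<close> factors, hence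
    the shift by one.\<close>
  moreover have "(\<Prod>k\<le>n. 1 - fps_X ^ Suc k) = qq (Suc n)" for n
    by (induction n) (simp_all add: qq_Suc mult_ac)
  ultimately have "(\<lambda>n. qq (Suc n)) \<longlonglongrightarrow> qq_inf" by simp
  thus ?thesis by (rule LIMSEQ_imp_Suc)
qed

text \<open>Letting the index tend to infinity in \<open>euler_sum_eq\<close> gives
  \<open>qq_inf * euler_sum 0 = 1\<close>; the other indices follow from \<open>euler_sum_eq\<close>
  again.\<close>

lemma euler_sum_mult_qq_inf: "qq_inf * euler_sum k = qq k"
proof -
  have "(\<lambda>k. qq k * euler_sum 0) \<longlonglongrightarrow> qq_inf * euler_sum 0"
    by (intro tendsto_mult_right qq_tendsto)
  hence "euler_sum \<longlonglongrightarrow> qq_inf * euler_sum 0"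
    by (subst (asm) euler_sum_eq[symmetric])
  hence "qq_inf * euler_sum 0 = 1"
    using euler_sum_tendsto by (rule LIMSEQ_unique)
  thus ?thesis
    by (subst euler_sum_eq) (metis mult.left_commute mult_1_right)
qed

section \<open>Consecutive series\<close>

text \<open>The two exponents that occur, \<open>k(3k+1)/2\<close> and \<open>(k+1)(3k+2)/2\<close>,
  are consecutive generalized pentagonal numbers.\<close>

definition pent_term :: "nat \<Rightarrow> rat fps" where
  "pent_term k = fps_X ^ (k * (3 * k + 1) div 2) * (1 - fps_X ^ (2 * k + 1))"

text \<open>With \<open>F m = q^((k choose 2) + (k+1)(k+m)) / ((q;q)_k (q;q)_m)\<close> the
  right-hand side is \<open>F (m+1) - q^(2k+1) F m\<close>, so summing over \<open>m\<close> reduces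
  two q-binomial series to one Euler series.\<close>

lemma M_term_consecutive:
  assumes "1 \<le> k"
  shows "M_term k (k + Suc m) + M_term (Suc k) (k + Suc m) =
           fps_X ^ ((k choose 2) + (k + 1) * (k + Suc m)) * inverse (qq k) * inverse (qq (Suc m)) -
           fps_X ^ (2 * k + 1) * (fps_X ^ ((k choose 2) + (k + 1) * (k + m)) * inverse (qq k) * inverse (qq m))"
proof -
  obtain j where j: "k = Suc j" using assms by (cases k) auto
  define x y z where "x = (fps_X :: rat fps) ^ k" and "y = (fps_X :: rat fps) ^ Suc m"
    and "z = (fps_X :: rat fps) ^ ((k choose 2) + (k + 1) * (k + Suc m))"
  define u v w Q where "u = inverse (qq k)" and "v = inverse (qq (Suc m))"
    and "w = inverse (qq (k + Suc m))" and "Q = qq (k + m)"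
  have inv: "w * Q * (1 - x * y) = 1"
  proof -
    have "qq (k + Suc m) = Q * (1 - x * y)"
      using qq_Suc[of "k + m"] by (simp add: Q_def x_def y_def power_add mult_ac)
    thus ?thesis using qq_mult_inverse[of "k + Suc m"] by (simp add: w_def mult_ac)
  qed
  have 1: "M_term k (k + Suc m) = z * w * (Q * (u * (1 - x)) * v)"
  proof -
    have "qbinom (k + m) (k - 1) = Q * (u * (1 - x)) * v"
      using qbinom_add[of j "Suc m"] inverse_qq[of j] by (simp add: j Q_def u_def v_def x_def)
    thus ?thesis by (simp add: M_term_def fps_divide_qq z_def w_def)
  qed
  have 2: "M_term (Suc k) (k + Suc m) = z * x * (x * y) * w * (Q * u * (v * (1 - y)))"
  proof -
    have "qbinom (k + m) k = Q * u * (v * (1 - y))"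
      using qbinom_add[of k m] inverse_qq[of m] by (simp add: Q_def u_def v_def y_def)
    moreover have "fps_X ^ ((Suc k choose 2) + (Suc k + 1) * (k + Suc m)) = z * x * (x * y)"
      by (simp add: z_def x_def y_def power_add[symmetric] numeral_2_eq_2 algebra_simps)
    ultimately show ?thesis by (simp add: M_term_def fps_divide_qq w_def)
  qed
  have 3: "fps_X ^ (2 * k + 1) * (fps_X ^ ((k choose 2) + (k + 1) * (k + m)) * inverse (qq k) * inverse (qq m))
             = z * x * u * (v * (1 - y))"
  proof -
    have "fps_X ^ (2 * k + 1) * fps_X ^ ((k choose 2) + (k + 1) * (k + m)) = z * x"
      by (simp add: z_def x_def power_add[symmetric] algebra_simps)
    moreover have "inverse (qq m) = v * (1 - y)"
      using inverse_qq[of m] by (simp add: v_def y_def)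
    ultimately show ?thesis by (simp only: u_def mult.assoc[symmetric])
  qed
  \<comment> \<open>The key is \<open>(1 - x) + x^2 y (1 - y) = (1 - x y) (1 - x (1 - y))\<close>;
    the factor \<open>1 - x y\<close> then cancels against \<open>w * Q\<close>.\<close>
  have "z * w * (Q * (u * (1 - x)) * v) + z * x * (x * y) * w * (Q * u * (v * (1 - y))) =
          (w * Q * (1 - x * y)) * (z * u * v - z * x * u * (v * (1 - y)))"
    by (simp add: algebra_simps)
  thus ?thesis unfolding 1 2 3 inv by (simp add: z_def u_def v_def)
qed

text \<open>Adding both series from \<open>n = k\<close> on, with a zero in front of the second,
  gives \<open>M_k + M_(k+1) + q^(2k+1) S = S\<close>, where \<open>S\<close> is the sum of
  \<open>F\<close>. As \<open>S\<close> is an Euler series over \<open>(q;q)_k\<close>,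
  multiplication by \<open>qq_inf\<close> clears both.\<close>

lemma M_gf_consecutive:
  assumes "1 \<le> k"
  shows "qq_inf * (M_gf k + M_gf (Suc k)) = pent_term k"
proof -
  define e where "e = k * (3 * k + 1) div 2"
  define F where "F = (\<lambda>m. fps_X ^ ((k choose 2) + (k + 1) * (k + m)) * inverse (qq k) * inverse (qq m) :: rat fps)"
  define S where "S = fps_X ^ e * inverse (qq k) * euler_sum k"
  have e: "(k choose 2) + (k + 1) * k = e"
  proof -
    have "2 * (k choose 2) = k * (k - 1)"
      by (cases k) (simp_all add: choose_two)
    hence "2 * ((k choose 2) + (k + 1) * k) = k * (3 * k + 1)"
      using assms by (cases k) (auto simp: algebra_simps)
    thus ?thesis unfolding e_def by simp
  qed
  have F: "(F has_sum S) UNIV"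
  proof -
    have "F = (\<lambda>m. fps_X ^ e * inverse (qq k) * (fps_X ^ (Suc k * m) * inverse (qq m)))"
    proof
      fix m
      have "(k choose 2) + (k + 1) * (k + m) = e + Suc k * m"
        using e by (simp add: algebra_simps)
      thus "F m = fps_X ^ e * inverse (qq k) * (fps_X ^ (Suc k * m) * inverse (qq m))"
        unfolding F_def by (simp only: power_add mult_ac)
    qed
    thus ?thesis
      unfolding S_def by (simp only: has_sum_cmult_right[OF has_sum_euler])
  qed
  have shift: "((\<lambda>m. f (l + m)) has_sum T) UNIV" if "(f has_sum T) {l..}" for f :: "nat \<Rightarrow> rat fps" and l T
    using that has_sum_reindex[of "\<lambda>m. l + m" UNIV f T] by (auto simp: o_def image_add_atLeast atLeast_0[symmetric] simp del: atLeast_0)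
  have M1: "((\<lambda>m. M_term k (k + m)) has_sum M_gf k) UNIV"
    by (intro shift has_sum_M_gf assms)
  have M2: "((\<lambda>m. if m = 0 then 0 else M_term (Suc k) (Suc k + (m - 1))) has_sum M_gf (Suc k)) UNIV"
    by (intro has_sum_Suc_shift shift has_sum_M_gf) simp
  have "((\<lambda>m. M_term k (k + m) + (if m = 0 then 0 else M_term (Suc k) (Suc k + (m - 1))) +
            (if m = 0 then 0 else fps_X ^ (2 * k + 1) * F (m - 1)))
          has_sum (M_gf k + M_gf (Suc k) + fps_X ^ (2 * k + 1) * S)) UNIV"
    by (intro has_sum_add M1 M2 has_sum_Suc_shift has_sum_cmult_right F)
  also have "(\<lambda>m. M_term k (k + m) + (if m = 0 then 0 else M_term (Suc k) (Suc k + (m - 1))) +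
            (if m = 0 then 0 else fps_X ^ (2 * k + 1) * F (m - 1))) = F"
  proof
    fix m
    show "M_term k (k + m) + (if m = 0 then 0 else M_term (Suc k) (Suc k + (m - 1))) +
            (if m = 0 then 0 else fps_X ^ (2 * k + 1) * F (m - 1)) = F m"
    proof (cases m)
      case 0
      have "qbinom (k - 1) (k - 1) = 1" by (rule qbinom_same)
      thus ?thesis using 0 by (simp add: M_term_def F_def fps_divide_qq)
    next
      case (Suc l)
      thus ?thesis using M_term_consecutive[OF assms, of l] by (simp add: F_def)
    qed
  qed
  finally have "M_gf k + M_gf (Suc k) + fps_X ^ (2 * k + 1) * S = S"
    using F by (rule has_sum_unique)
  hence "M_gf k + M_gf (Suc k) = (1 - fps_X ^ (2 * k + 1)) * S"
    by (simp add: algebra_simps)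
  hence "qq_inf * (M_gf k + M_gf (Suc k)) =
           (1 - fps_X ^ (2 * k + 1)) * fps_X ^ e * inverse (qq k) * (qq_inf * euler_sum k)"
    by (simp add: S_def mult_ac)
  also have "\<dots> = (1 - fps_X ^ (2 * k + 1)) * fps_X ^ e * (qq k * inverse (qq k))"
    unfolding euler_sum_mult_qq_inf by (simp only: mult_ac)
  finally show ?thesis
    by (simp add: pent_term_def e_def mult_ac)
qed

text \<open>Serves as the case \<open>k = 0\<close> of the consecutive relation, with 1 as first
  summand: the series of \<open>M_gf 1\<close> is Euler's series at \<open>z = q^2\<close> without
  its term \<open>m = 0\<close>.\<close>

lemma M_gf_1: "qq_inf * (1 + M_gf 1) = pent_term 0"
proof -
  have "((\<lambda>m. fps_X ^ (Suc 1 * m) * inverse (qq m)) has_sum (1 + M_gf 1)) ({0} \<union> {1..})"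
  proof (rule has_sum_Un_disjoint)
    have "((\<lambda>m. fps_X ^ (Suc 1 * m) * inverse (qq m)) has_sum
            (\<Sum>m\<in>{0}. fps_X ^ (Suc 1 * m) * inverse (qq m))) {0}"
      by (rule has_sum_finite) simp
    thus "((\<lambda>m. fps_X ^ (Suc 1 * m) * inverse (qq m) :: rat fps) has_sum 1) {0}"
      by simp
    show "((\<lambda>m. fps_X ^ (Suc 1 * m) * inverse (qq m)) has_sum M_gf 1) {1..}"
      using has_sum_M_gf[of 1] by (simp add: M_term_def[abs_def] fps_divide_qq binomial_eq_0)
  qed auto
  moreover have "{0} \<union> {1..} = (UNIV :: nat set)" by auto
  ultimately have "1 + M_gf 1 = euler_sum 1"
    using has_sum_euler[of 1] has_sum_unique by metis
  thus ?thesis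
    using euler_sum_mult_qq_inf[of 1] by (simp add: pent_term_def qq_Suc)
qed

section \<open>The false theta function\<close>

definition theta_term :: "int \<Rightarrow> rat fps" where
  "theta_term n = (- (fps_X ^ 2)) ^ nat (n * (n + 1) div 2) * fps_X ^ nat (n * (n - 1) div 2)"

definition theta_pair :: "nat \<Rightarrow> rat fps" where
  "theta_pair i = (-1) ^ (i * (i + 1) div 2) * pent_term i"

lemma theta_term_eq:
  assumes "n * (n + 1) = int (2 * a)" "n * (n - 1) = int (2 * b)"
  shows "theta_term n = (-1) ^ a * fps_X ^ (2 * a + b)"
  unfolding theta_term_def assms
  by (simp add: power_minus[of "fps_X ^ 2"] power_mult[symmetric] power_add mult_ac)

text \<open>With \<open>a = i(i+1)/2\<close>, both indices give \<open>-q^2\<close> the exponent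
  \<open>a\<close>, hence equal signs, while \<open>q\<close> gets the exponents
  \<open>a - i\<close> and \<open>a + i + 1\<close>. The minus sign of the false theta function
  produces the factor \<open>1 - q^(2i+1)\<close>.\<close>

lemma theta_term_diff: "theta_term (int i) - theta_term (- int i - 1) = theta_pair i"
proof -
  obtain a where a: "i * (i + 1) = 2 * a"
    by (rule evenE[of "i * (i + 1)"]) simp_all
  have b: "(i + 1) * (i + 2) = 2 * (a + i + 1)"
    using a by (simp add: algebra_simps)
  have "theta_term (int i) = (-1) ^ a * fps_X ^ (2 * a + (a - i))"
  proof (rule theta_term_eq)
    show "int i * (int i + 1) = int (2 * a)"
      using arg_cong[OF a, of int] by (simp add: algebra_simps)
    have "i \<le> a" using a by (cases i) auto
    thus "int i * (int i - 1) = int (2 * (a - i))"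
      using arg_cong[OF a, of int] by (simp add: of_nat_diff algebra_simps)
  qed
  moreover have "theta_term (- int i - 1) = (-1) ^ a * fps_X ^ (2 * a + (a + i + 1))"
  proof (rule theta_term_eq)
    show "(- int i - 1) * (- int i - 1 + 1) = int (2 * a)"
      using arg_cong[OF a, of int] by (simp add: algebra_simps)
    show "(- int i - 1) * (- int i - 1 - 1) = int (2 * (a + i + 1))"
      using arg_cong[OF b, of int] by (simp add: algebra_simps)
  qed
  moreover have "i \<le> a" using a by (cases i) auto
  moreover have "i * (3 * i + 1) = 2 * (2 * a + (a - i))"
    using a \<open>i \<le> a\<close> by (simp add: algebra_simps diff_mult_distrib2)
  hence "i * (3 * i + 1) div 2 = 2 * a + (a - i)" by simp
  moreover have "2 * a + (a + i + 1) = (2 * a + (a - i)) + (2 * i + 1)"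
    using \<open>i \<le> a\<close> by simp
  ultimately show ?thesis
    unfolding theta_pair_def pent_term_def a
    by (simp only: power_add nonzero_mult_div_cancel_left[OF zero_neq_numeral[symmetric]])
       (simp add: algebra_simps)
qed

text \<open>Every integer is \<open>i\<close> or \<open>-i - 1\<close> for a unique natural
  \<open>i\<close>, which folds the two half-sums into one sum over pairs.\<close>

lemma has_sum_theta_pair: "(theta_pair has_sum false_theta (- (fps_X ^ 2)) fps_X) UNIV"
proof -
  have sum: "(theta_term has_sum infsum theta_term A) A" for A
    using summable_false_theta[of A] by (intro has_sum_infsum) (simp only: theta_term_def[abs_def])
  have "((\<lambda>i. theta_term (int i)) has_sum infsum theta_term {0..}) UNIV"
    using sum by (subst has_sum_reindex_bij_witness[where T = "{0..}" and h = theta_term and i = nat and j = int]) auto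
  moreover have "((\<lambda>i. theta_term (- int i - 1)) has_sum infsum theta_term {..-1}) UNIV"
    using sum by (subst has_sum_reindex_bij_witness[where T = "{..-1}" and h = theta_term
        and i = "\<lambda>n. nat (- n - 1)" and j = "\<lambda>i. - int i - 1"]) auto
  ultimately have "((\<lambda>i. theta_term (int i) + (-1) * theta_term (- int i - 1)) has_sum
      (infsum theta_term {0..} + (-1) * infsum theta_term {..-1})) UNIV"
    by (intro has_sum_add has_sum_cmult_right)
  moreover have "false_theta (- (fps_X ^ 2)) fps_X = infsum theta_term {0..} - infsum theta_term {..-1}"
    by (simp only: false_theta_def theta_term_def[abs_def])
  ultimately show ?thesis
    by (simp add: theta_term_diff)
qed

section \<open>Telescoping\<close>

lemma theta_pair_even_odd:
  "theta_pair (2 * j) + theta_pair (2 * j + 1) = (-1) ^ j * (pent_term (2 * j) - pent_term (2 * j + 1))"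
proof -
  have "2 * j * (2 * j + 1) div 2 = j + 2 * (j * j)"
    by (simp add: algebra_simps)
  moreover have "(2 * j + 1) * (2 * j + 1 + 1) = 2 * (j + 1 + 2 * (j * (j + 1)))"
    by (simp add: algebra_simps)
  hence "(2 * j + 1) * (2 * j + 1 + 1) div 2 = j + 1 + 2 * (j * (j + 1))"
    by simp
  \<comment> \<open>Only parities matter: the exponents are congruent to \<open>j\<close> and
    \<open>j + 1\<close> modulo 2, so the two signs are opposite.\<close>
  moreover have "(-1) ^ (a + 2 * b) = ((-1) ^ a :: rat fps)" for a b
    by (simp add: power_add power_mult)
  ultimately show ?thesis
    unfolding theta_pair_def by (simp only:) (simp add: algebra_simps)
qed

text \<open>For \<open>j \<ge> 1\<close> the odd-indexed series cancels in
  \<open>pent_term (2 * j) - pent_term (2 * j + 1)\<close>, leaving \<open>qq_inf\<close> times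
  \<open>M_(2j) - M_(2j+2)\<close>; for \<open>j = 0\<close> it leaves \<open>1 - M_2\<close>. Every
  even-indexed series thus occurs twice except the last.\<close>

lemma sum_theta_pair:
  "(\<Sum>i<2 * Suc J. theta_pair i) =
     qq_inf * (1 - 2 * (\<Sum>j\<in>{1..<Suc J}. (-1) ^ (j + 1) * M_gf (2 * j)) - (-1) ^ J * M_gf (2 * Suc J))"
proof (induction J)
  case 0
  have "(\<Sum>i<2 * Suc 0. theta_pair i) = pent_term 0 - pent_term 1"
    using theta_pair_even_odd[of 0] by (simp add: numeral_2_eq_2)
  also have "\<dots> = qq_inf * (1 + M_gf 1) - qq_inf * (M_gf 1 + M_gf 2)"
    using M_gf_1 M_gf_consecutive[of 1] by (simp add: numeral_2_eq_2)
  finally show ?case by (simp add: algebra_simps numeral_2_eq_2)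
next
  case (Suc J)
  define j where "j = Suc J"
  define s where "s = (\<Sum>j\<in>{1..<Suc J}. (-1) ^ (j + 1) * M_gf (2 * j))"
  have pent: "pent_term (2 * j) - pent_term (2 * j + 1) = qq_inf * (M_gf (2 * j) - M_gf (2 * Suc j))"
  proof -
    have "pent_term (2 * j) = qq_inf * (M_gf (2 * j) + M_gf (2 * j + 1))"
         "pent_term (2 * j + 1) = qq_inf * (M_gf (2 * j + 1) + M_gf (2 * Suc j))"
      using M_gf_consecutive[of "2 * j"] M_gf_consecutive[of "2 * j + 1"] by (simp_all add: j_def)
    thus ?thesis by (simp only: right_diff_distrib distrib_left add_diff_add) simp
  qed
  have "(\<Sum>i<2 * Suc j. theta_pair i) =
          (\<Sum>i<2 * j. theta_pair i) + (theta_pair (2 * j) + theta_pair (2 * j + 1))"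
    by (simp add: add.assoc)
  also have "\<dots> = qq_inf * (1 - 2 * s + (-1) ^ j * M_gf (2 * j)) +
                   (-1) ^ j * (qq_inf * (M_gf (2 * j) - M_gf (2 * Suc j)))"
    unfolding theta_pair_even_odd pent using Suc by (simp add: s_def j_def)
  \<comment> \<open>The old boundary term and the new contribution are both
    \<open>(-1)^j M_(2j)\<close>; this is the origin of the factor 2.\<close>
  also have "\<dots> = qq_inf * (1 - 2 * (s + (-1) ^ (j + 1) * M_gf (2 * j)) - (-1) ^ j * M_gf (2 * Suc j))"
    by (simp add: algebra_simps)
  also have "s + (-1) ^ (j + 1) * M_gf (2 * j) = (\<Sum>j\<in>{1..<Suc j}. (-1) ^ (j + 1) * M_gf (2 * j))"
    by (simp add: s_def j_def)
  finally show ?case by (simp only: j_def)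
qed

text \<open>A partition whose least missing part is \<open>k \<ge> 2\<close> contains
  \<open>k - 1\<close>, so the order of the series grows with the index.\<close>

lemma M_gf_tendsto_0: "(\<lambda>J. (-1) ^ J * M_gf (2 * Suc J)) \<longlonglongrightarrow> 0"
proof (rule tendsto_fpsI)
  fix n
  show "\<forall>\<^sub>F J in sequentially. fps_nth ((-1) ^ J * M_gf (2 * Suc J)) n = fps_nth 0 n"
    using eventually_ge_at_top[of n]
    by eventually_elim (simp only: neg_one_power_mult_nth M_gf_def, simp add: M_count_eq_0)
qed

theorem theorem5:
  shows "false_theta (- (fps_X ^ 2)) fps_X =
           qq_inf * (1 - 2 * (\<Sum>\<^sub>\<infinity>j\<in>{1..}. (-1) ^ (j + 1) * M_gf (2 * j))) \<and>
         qq_inf * (1 - 2 * (\<Sum>\<^sub>\<infinity>j\<in>{1..}. (-1) ^ (j + 1) * M_gf (2 * j))) =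
           qq_inf * (1 - 2 * (\<Sum>\<^sub>\<infinity>j\<in>{1..}. (-1) ^ (j + 1) *
             (\<Sum>\<^sub>\<infinity>n\<in>{2 * j..}. fps_X ^ ((2 * j choose 2) + (2 * j + 1) * n) / qq n *
                qbinom (n - 1) (2 * j - 1))))"
proof
  define S where "S = (\<Sum>\<^sub>\<infinity>j\<in>{1..}. (-1) ^ (j + 1) * M_gf (2 * j))"
  have "(\<lambda>n. \<Sum>i\<in>{0..<n}. theta_pair i) \<longlonglongrightarrow> false_theta (- (fps_X ^ 2)) fps_X"
    by (rule has_sum_partial_sums) (simp add: has_sum_theta_pair)
  \<comment> \<open>The telescoped formula covers even numbers of pairs, so the limit is taken along
    that subsequence.\<close>
  moreover have "filterlim (\<lambda>J. 2 * Suc J) at_top sequentially"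
    by (rule filterlim_subseq) (simp add: strict_mono_def)
  ultimately have "(\<lambda>J. \<Sum>i\<in>{0..<2 * Suc J}. theta_pair i) \<longlonglongrightarrow> false_theta (- (fps_X ^ 2)) fps_X"
    by (rule filterlim_compose)
  moreover have "(\<lambda>n. \<Sum>j\<in>{1..<n}. (-1) ^ (j + 1) * M_gf (2 * j)) \<longlonglongrightarrow> S"
    unfolding S_def by (rule has_sum_partial_sums[OF has_sum_infsum[OF summable_M_gf]])
  hence "(\<lambda>J. \<Sum>j\<in>{1..<Suc J}. (-1) ^ (j + 1) * M_gf (2 * j)) \<longlonglongrightarrow> S"
    by (rule LIMSEQ_Suc)
  hence "(\<lambda>J. qq_inf * (1 + (-2) * (\<Sum>j\<in>{1..<Suc J}. (-1) ^ (j + 1) * M_gf (2 * j)) +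
                 (-1) * ((-1) ^ J * M_gf (2 * Suc J)))) \<longlonglongrightarrow> qq_inf * (1 + (-2) * S + (-1) * 0)"
    by (intro tendsto_mult_left tendsto_add tendsto_const M_gf_tendsto_0)
  ultimately have "false_theta (- (fps_X ^ 2)) fps_X = qq_inf * (1 - 2 * S)"
    using sum_theta_pair by (simp add: atLeast0LessThan LIMSEQ_unique del: sum.lessThan_Suc)
  thus "false_theta (- (fps_X ^ 2)) fps_X =
          qq_inf * (1 - 2 * (\<Sum>\<^sub>\<infinity>j\<in>{1..}. (-1) ^ (j + 1) * M_gf (2 * j)))"
    by (simp only: S_def)
  \<comment> \<open>The second equality is the Andrews--Merca series inside each summand;
    \<open>j \<ge> 1\<close> makes \<open>2 * j\<close> positive.\<close>
  have "M_gf (2 * j) = (\<Sum>\<^sub>\<infinity>n\<in>{2 * j..}. fps_X ^ ((2 * j choose 2) + (2 * j + 1) * n) / qq n *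
          qbinom (n - 1) (2 * j - 1))" if "j \<in> {1..}" for j
    using has_sum_M_gf[of "2 * j", THEN infsumI] that by (simp add: M_term_def[abs_def])
  hence "S = (\<Sum>\<^sub>\<infinity>j\<in>{1..}. (-1) ^ (j + 1) *
           (\<Sum>\<^sub>\<infinity>n\<in>{2 * j..}. fps_X ^ ((2 * j choose 2) + (2 * j + 1) * n) / qq n *
              qbinom (n - 1) (2 * j - 1)))"
    unfolding S_def by (intro infsum_cong) (simp only:)
  thus "qq_inf * (1 - 2 * (\<Sum>\<^sub>\<infinity>j\<in>{1..}. (-1) ^ (j + 1) * M_gf (2 * j))) =
           qq_inf * (1 - 2 * (\<Sum>\<^sub>\<infinity>j\<in>{1..}. (-1) ^ (j + 1) *
             (\<Sum>\<^sub>\<infinity>n\<in>{2 * j..}. fps_X ^ ((2 * j choose 2) + (2 * j + 1) * n) / qq n *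
                qbinom (n - 1) (2 * j - 1))))"
    by (simp only: S_def[symmetric])
qed

end
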